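(* Let $1\le k\le n$ and $(a_1,\ldots,a_n)\in\mathbb{H}^n$ with $a_l\notin\mathbb{R}$ for every $1\le l\le k$. A slice regular polynomial $P\in\mathbb{H}[q_1,\ldots,q_n]$ vanishes on $\mathbb{S}_{a_1}\times\cdots\times\mathbb{S}_{a_k}\times\{a_{k+1}\}\times\cdots\times\{a_n\}\subset\mathbb{H}^n$ if and only if there exist $P_l\in\mathbb{H}[q_1,\ldots,q_n]$ for $l=1,\ldots,k$ and $P_l\in\mathbb{H}[q_1,\ldots,q_l]$ for $l=k+1,\ldots,n$ such that $$P(q_1,\ldots,q_n)=\sum_{l=1}^k S_{a_l}*P_l(q_1,\ldots,q_n)+\sum_{l=k+1}^n(q_l-a_l)*P_l(q_1,\ldots,q_l).$$ If moreover $a_la_m=a_ma_l$ for any $l,m>k$, then $P$ vanishes on $\mathbb{S}_{a_1}\times\cdots\times\mathbb{S}_{a_k}\times\{a_{k+1}\}\times\cdots\times\{a_n\}$ if and only if $P$ is of the form $$P(q_1,\ldots,q_n)=\sum_{l=1}^k S_{a_l}*P_l(q_1,\ldots,q_n)+\sum_{l=k+1}^n(q_l-a_l)*P_l(q_1,\ldots,q_n)$$ with $P_l\in\mathbb{H}[q_1,\ldots,q_n]$ for any $l=1,\ldots,n$.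
   Context: $\mathbb{H}$ is the skew field of quaternions. A slice regular polynomial in $n$ variables is a function $P:\mathbb{H}^n\to\mathbb{H}$ of the form $P(q_1,\ldots,q_n)=\sum_{\ell} q_1^{\ell_1}\cdots q_n^{\ell_n}a_{\ell_1,\ldots,\ell_n}$ (finite sum over multi-indices, variables in this fixed order, coefficients in $\mathbb{H}$ on the right). $\mathbb{H}[q_1,\ldots,q_n]$ is the set of these; it is a (non-commutative) ring under $+$ and the $*$-product, the biadditive extension of $(q_1^{\ell_1}\cdots q_n^{\ell_n}a)*(q_1^{m_1}\cdots q_n^{m_n}b)=q_1^{\ell_1+m_1}\cdots q_n^{\ell_n+m_n}ab$. Polynomials in fewer variables, such as elements of $\mathbb{H}[q_1,\ldots,q_l]$, are regarded as elements of $\mathbb{H}[q_1,\ldots,q_n]$. Let $\mathbb{S}=\{q\in\mathbb{H}:q^2=-1\}$. For $a\in\mathbb{H}$, $\mathbb{S}_a=\{\mathrm{Re}(a)+J|\mathrm{Im}(a)| : J\in\mathbb{S}\}$, where $\mathrm{Im}(a)=a-\mathrm{Re}(a)$. For each $l$, $S_{a_l}$ denotes the polynomial $S_{a_l}(q_l)=q_l^2-2\,\mathrm{Re}(a_l)q_l+|a_l|^2$ in the variable $q_l$. *)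

theory Defs
  imports "HOL-Analysis.Analysis" "HOL-Library.Poly_Mapping"
begin

section \<open>Quaternions\<close>

text \<open>\<^term>\<open>Quat x y z w\<close> stands for x + y i + z j + w k.\<close>

datatype quat = Quat (qRe: real) (qI: real) (qJ: real) (qK: real)

lemma quat_eq_iff: "p = q \<longleftrightarrow> qRe p = qRe q \<and> qI p = qI q \<and> qJ p = qJ q \<and> qK p = qK q"
  by (cases p; cases q) simp

instantiation quat :: ring_1
begin

definition "0 = Quat 0 0 0 0"
definition "1 = Quat 1 0 0 0"
definition "p + q = Quat (qRe p + qRe q) (qI p + qI q) (qJ p + qJ q) (qK p + qK q)"
definition "p - q = Quat (qRe p - qRe q) (qI p - qI q) (qJ p - qJ q) (qK p - qK q)"
definition "- q = Quat (- qRe q) (- qI q) (- qJ q) (- qK q)"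
definition "p * q = Quat
   (qRe p * qRe q - qI p * qI q - qJ p * qJ q - qK p * qK q)
   (qRe p * qI q + qI p * qRe q + qJ p * qK q - qK p * qJ q)
   (qRe p * qJ q - qI p * qK q + qJ p * qRe q + qK p * qI q)
   (qRe p * qK q + qI p * qJ q - qJ p * qI q + qK p * qRe q)"

instance
  by standard (simp_all add: zero_quat_def one_quat_def plus_quat_def minus_quat_def
      uminus_quat_def times_quat_def algebra_simps)

end

instantiation quat :: real_vector
begin

definition "r *\<^sub>R q = Quat (r * qRe q) (r * qI q) (r * qJ q) (r * qK q)"

instance
  by standard (simp_all add: scaleR_quat_def plus_quat_def algebra_simps)

end

instantiation quat :: real_inner
begin

definition "inner p q = qRe p * qRe q + qI p * qI q + qJ p * qJ q + qK p * qK q"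
definition "norm (q :: quat) = sqrt (inner q q)"
definition "sgn (q :: quat) = q /\<^sub>R norm q"
definition "dist (p :: quat) q = norm (p - q)"
definition "(uniformity :: (quat \<times> quat) filter) = (INF e\<in>{0 <..}. principal {(x, y). dist x y < e})"
definition "open (U :: quat set) \<longleftrightarrow>
  (\<forall>x\<in>U. eventually (\<lambda>(x', y). x' = x \<longrightarrow> y \<in> U) uniformity)"

instance
proof
  fix x y z :: quat and r s :: real
  show "0 \<le> inner x x"
    by (simp add: inner_quat_def)
  have "inner x x = (qRe x)\<^sup>2 + (qI x)\<^sup>2 + (qJ x)\<^sup>2 + (qK x)\<^sup>2"
    by (simp add: inner_quat_def power2_eq_square)
  moreover have "\<dots> = 0 \<longleftrightarrow> qRe x = 0 \<and> qI x = 0 \<and> qJ x = 0 \<and> qK x = 0"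
    by (smt (verit) zero_le_power2 zero_eq_power2)
  ultimately show "inner x x = 0 \<longleftrightarrow> x = 0"
    by (simp add: quat_eq_iff zero_quat_def)
qed (simp_all add: scaleR_quat_def inner_quat_def norm_quat_def sgn_quat_def dist_quat_def
      uniformity_quat_def open_quat_def plus_quat_def algebra_simps)

end

instantiation quat :: real_normed_div_algebra
begin

definition "inverse (q :: quat) =
  Quat (qRe q) (- qI q) (- qJ q) (- qK q) /\<^sub>R (norm q)\<^sup>2"
definition "p div (q :: quat) = p * inverse q"

instance
proof
  fix x y :: quat and r :: real
  show "norm (x * y) = norm x * norm y"
    unfolding norm_quat_def inner_quat_def times_quat_def real_sqrt_mult [symmetric]
    by (simp add: algebra_simps)
  show "r *\<^sub>R x * y = r *\<^sub>R (x * y)" "x * r *\<^sub>R y = r *\<^sub>R (x * y)"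
    by (simp_all add: times_quat_def scaleR_quat_def algebra_simps)
  show "x div y = x * inverse y"
    by (simp add: divide_quat_def)
  show "inverse (0 :: quat) = 0"
    by (simp add: inverse_quat_def scaleR_quat_def zero_quat_def)
  assume "x \<noteq> 0"
  then have "norm x \<noteq> 0"
    by simp
  then have nz: "inverse ((norm x)\<^sup>2) * (norm x)\<^sup>2 = 1"
    by simp
  have nx: "(norm x)\<^sup>2 = qRe x * qRe x + qI x * qI x + qJ x * qJ x + qK x * qK x"
    unfolding power2_norm_eq_inner by (simp add: inner_quat_def)
  show "inverse x * x = 1" "x * inverse x = 1"
    unfolding inverse_quat_def using nz unfolding nx
    by (simp_all add: times_quat_def scaleR_quat_def one_quat_def algebra_simps)
qed

end

definition qIm :: "quat \<Rightarrow> quat" where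
  "qIm a = a - of_real (qRe a)"

definition imag_units :: "quat set" where
  "imag_units = {q. q\<^sup>2 = - 1}"

definition sphere_of :: "quat \<Rightarrow> quat set" where
  "sphere_of a = {of_real (qRe a) + J * of_real (norm (qIm a)) | J. J \<in> imag_units}"


section \<open>Slice regular polynomials\<close>

text \<open>
  A multi-index is a finitely supported exponent function \<^typ>\<open>nat \<Rightarrow>\<^sub>0 nat\<close>, the variables being
  numbered from 1, and a polynomial is stored as its family of coefficients. The ring
  multiplication of \<^typ>\<open>(nat \<Rightarrow>\<^sub>0 nat) \<Rightarrow>\<^sub>0 quat\<close> is the \<open>*\<close>-product: it is biadditive and multiplies
  monomials by adding exponents and multiplying coefficients in order (lemma \<open>mult_single\<close>).
  Identifying a polynomial with the function it induces is legitimate by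
  \<open>slice_eval_inj_on\<close> below.
\<close>

type_synonym slice_poly = "(nat \<Rightarrow>\<^sub>0 nat) \<Rightarrow>\<^sub>0 quat"

text \<open>
  \<open>slice_polys n\<close> is the ring of polynomials in the variables \<open>1, \<dots>, n\<close>; thus
  \<open>slice_polys l \<subseteq> slice_polys n\<close> for \<open>l \<le> n\<close>.
\<close>

definition slice_polys :: "nat \<Rightarrow> slice_poly set" where
  "slice_polys n = {P. \<forall>m \<in> Poly_Mapping.keys P. Poly_Mapping.keys m \<subseteq> {1..n}}"

text \<open>The order of the factors matters: variables in increasing order, coefficient on the right.\<close>

definition slice_eval :: "nat \<Rightarrow> slice_poly \<Rightarrow> (nat \<Rightarrow> quat) \<Rightarrow> quat" where
  "slice_eval n P q =
    (\<Sum>m \<in> Poly_Mapping.keys P.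
      prod_list (map (\<lambda>i. q i ^ Poly_Mapping.lookup m i) [1..<Suc n]) * Poly_Mapping.lookup P m)"

definition slice_const :: "quat \<Rightarrow> slice_poly" where
  "slice_const c = Poly_Mapping.single 0 c"

definition slice_var :: "nat \<Rightarrow> slice_poly" where
  "slice_var l = Poly_Mapping.single (Poly_Mapping.single l 1) 1"

definition sphere_poly :: "nat \<Rightarrow> quat \<Rightarrow> slice_poly" where
  "sphere_poly l a = slice_var l ^ 2 - slice_var l * slice_const (of_real (2 * qRe a))
     + slice_const (of_real ((norm a)\<^sup>2))"

definition spheres_points :: "nat \<Rightarrow> nat \<Rightarrow> (nat \<Rightarrow> quat) \<Rightarrow> (nat \<Rightarrow> quat) set" where
  "spheres_points k n a = (\<Pi>\<^sub>E l\<in>{1..n}. if l \<le> k then sphere_of (a l) else {a l})"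


section \<open>A polynomial is determined by its values\<close>

lemma real_monomials_independent:
  fixes c :: "(nat \<Rightarrow>\<^sub>0 nat) \<Rightarrow> real"
  assumes "finite K"
    and "\<And>l m. \<lbrakk>l \<in> K; m \<in> K; \<And>i. i \<in> {1..n} \<Longrightarrow> Poly_Mapping.lookup l i = Poly_Mapping.lookup m i\<rbrakk> \<Longrightarrow> l = m"
    and "\<And>x :: nat \<Rightarrow> real. (\<Sum>m\<in>K. (\<Prod>i=1..n. x i ^ Poly_Mapping.lookup m i) * c m) = 0"
    and "m \<in> K"
  shows "c m = 0"
  using assms
proof (induction n arbitrary: K m)
  case 0
  then have "K = {m}" by auto
  with "0.prems"(3) show ?case by simp
next
  case (Suc n)
  let ?d = "\<lambda>m. Poly_Mapping.lookup m (Suc n)"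
  let ?K = "{l \<in> K. ?d l = ?d m}"
  show ?case
  proof (rule Suc.IH[of ?K])
    show "finite ?K" "m \<in> ?K" using Suc.prems by auto
    fix l l' assume *: "l \<in> ?K" "l' \<in> ?K" "\<And>i. i \<in> {1..n} \<Longrightarrow> Poly_Mapping.lookup l i = Poly_Mapping.lookup l' i"
    show "l = l'"
    proof (rule Suc.prems(2))
      show "l \<in> K" "l' \<in> K" using * by auto
      fix i assume "i \<in> {1..Suc n}"
      with * show "Poly_Mapping.lookup l i = Poly_Mapping.lookup l' i" by (cases "i = Suc n") auto
    qed
  next
    fix x :: "nat \<Rightarrow> real"
    define N where "N = Max (?d ` K)"
    define C where "C j = (\<Sum>l\<in>{l \<in> K. ?d l = j}. (\<Prod>i=1..n. x i ^ Poly_Mapping.lookup l i) * c l)" for j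
    have dN: "?d l \<le> N" if "l \<in> K" for l
      using that Suc.prems(1) by (simp add: N_def)
    have "(\<Sum>j\<le>N. C j * t ^ j) = 0" for t
    proof -
      have pr: "(\<Prod>i=1..Suc n. (x(Suc n := t)) i ^ Poly_Mapping.lookup l i)
          = (\<Prod>i=1..n. x i ^ Poly_Mapping.lookup l i) * t ^ ?d l" for l :: "nat \<Rightarrow>\<^sub>0 nat"
        by simp
      have "(\<Sum>j\<le>N. C j * t ^ j)
          = (\<Sum>j\<le>N. \<Sum>l\<in>{l \<in> K. ?d l = j}. (\<Prod>i=1..Suc n. (x(Suc n := t)) i ^ Poly_Mapping.lookup l i) * c l)"
        unfolding pr C_def sum_distrib_right
        by (intro sum.cong refl) (auto simp: algebra_simps)
      also have "\<dots> = (\<Sum>l\<in>K. (\<Prod>i=1..Suc n. (x(Suc n := t)) i ^ Poly_Mapping.lookup l i) * c l)"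
        by (rule sum.group) (use Suc.prems(1) dN in auto)
      finally show ?thesis using Suc.prems(3)[of "x(Suc n := t)"] by simp
    qed
    then have "C (?d m) = 0"
      using Transcendental.polyfun_eq_0[of C N] dN[OF Suc.prems(4)] by auto
    then show "(\<Sum>l\<in>?K. (\<Prod>i=1..n. x i ^ Poly_Mapping.lookup l i) * c l) = 0"
      by (simp add: C_def)
  qed
qed

lemma slice_eval_eq_sum:
  assumes "finite K" "Poly_Mapping.keys P \<subseteq> K"
  shows "slice_eval n P q =
    (\<Sum>m\<in>K. prod_list (map (\<lambda>i. q i ^ Poly_Mapping.lookup m i) [1..<Suc n]) * Poly_Mapping.lookup P m)"
  unfolding slice_eval_def
  by (rule sum.mono_neutral_left) (use assms in \<open>auto simp: in_keys_iff\<close>)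

lemma slice_eval_diff: "slice_eval n (P - Q) q = slice_eval n P q - slice_eval n Q q"
proof -
  let ?K = "Poly_Mapping.keys P \<union> Poly_Mapping.keys Q"
  have "Poly_Mapping.keys (P - Q) \<subseteq> ?K"
    by (auto simp: in_keys_iff lookup_minus)
  then show ?thesis
    by (simp add: slice_eval_eq_sum[of ?K] lookup_minus right_diff_distrib sum_subtractf)
qed

lemma slice_poly_eq_0:
  assumes P: "P \<in> slice_polys n"
    and z: "\<And>q. q \<in> ({1..n} \<rightarrow>\<^sub>E UNIV) \<Longrightarrow> slice_eval n P q = 0"
  shows "P = 0"
proof -
  let ?K = "Poly_Mapping.keys P"
  have inj: "l = m" if "l \<in> ?K" "m \<in> ?K" "\<And>i. i \<in> {1..n} \<Longrightarrow> Poly_Mapping.lookup l i = Poly_Mapping.lookup m i" for l m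
  proof (rule poly_mapping_eqI)
    fix i
    have "Poly_Mapping.keys l \<subseteq> {1..n}" "Poly_Mapping.keys m \<subseteq> {1..n}"
      using P that by (auto simp: slice_polys_def)
    then have "i \<notin> {1..n} \<Longrightarrow> i \<notin> Poly_Mapping.keys l \<and> i \<notin> Poly_Mapping.keys m"
      by blast
    then show "Poly_Mapping.lookup l i = Poly_Mapping.lookup m i"
      using that(3)[of i] by (metis in_keys_iff)
  qed
  have val: "(\<Sum>m\<in>?K. (\<Prod>i=1..n. x i ^ Poly_Mapping.lookup m i) *\<^sub>R Poly_Mapping.lookup P m) = 0" for x :: "nat \<Rightarrow> real"
  proof -
    let ?q = "restrict (\<lambda>i. of_real (x i) :: quat) {1..n}"
    have "prod_list (map (\<lambda>i. ?q i ^ Poly_Mapping.lookup m i) [1..<Suc n])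
        = of_real (\<Prod>i=1..n. x i ^ Poly_Mapping.lookup m i)" for m :: "nat \<Rightarrow>\<^sub>0 nat"
    proof -
      have "prod_list (map (\<lambda>i. ?q i ^ Poly_Mapping.lookup m i) [1..<Suc n])
          = prod_list (map (\<lambda>i. of_real (x i ^ Poly_Mapping.lookup m i)) [1..<Suc n])"
        by (intro arg_cong[where f = prod_list] map_cong) auto
      also have "\<dots> = of_real (\<Prod>i=1..n. x i ^ Poly_Mapping.lookup m i)"
        by (induction n) auto
      finally show ?thesis .
    qed
    then show ?thesis
      using z[of ?q] by (simp add: slice_eval_def scaleR_conv_of_real)
  qed
  have "f (Poly_Mapping.lookup P m) = 0" if f: "linear f" and m: "m \<in> ?K" for f :: "quat \<Rightarrow> real" and m
  proof (rule real_monomials_independent[OF _ inj _ m])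
    fix x :: "nat \<Rightarrow> real"
    have "f (\<Sum>m\<in>?K. (\<Prod>i=1..n. x i ^ Poly_Mapping.lookup m i) *\<^sub>R Poly_Mapping.lookup P m) = 0"
      unfolding val by (rule linear_0[OF f])
    then show "(\<Sum>m\<in>?K. (\<Prod>i=1..n. x i ^ Poly_Mapping.lookup m i) * f (Poly_Mapping.lookup P m)) = 0"
      by (simp add: linear_sum[OF f] linear_scale[OF f])
  qed auto
  moreover have "linear qRe" "linear qI" "linear qJ" "linear qK"
    by (auto intro!: linearI simp: plus_quat_def scaleR_quat_def)
  ultimately have "Poly_Mapping.lookup P m = 0" if "m \<in> ?K" for m
    using that by (simp add: quat_eq_iff zero_quat_def)
  then show ?thesis
    by (metis in_keys_iff lookup_zero poly_mapping_eqI)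
qed

lemma slice_eval_inj_on:
  "inj_on (\<lambda>P. restrict (slice_eval n P) ({1..n} \<rightarrow>\<^sub>E UNIV)) (slice_polys n)"
proof (rule inj_onI)
  fix P Q assume P: "P \<in> slice_polys n" and Q: "Q \<in> slice_polys n"
    and eq: "restrict (slice_eval n P) ({1..n} \<rightarrow>\<^sub>E UNIV) = restrict (slice_eval n Q) ({1..n} \<rightarrow>\<^sub>E UNIV)"
  have "Poly_Mapping.keys (P - Q) \<subseteq> Poly_Mapping.keys P \<union> Poly_Mapping.keys Q"
    by (auto simp: in_keys_iff lookup_minus)
  then have "P - Q \<in> slice_polys n"
    using P Q unfolding slice_polys_def by blast
  moreover have "slice_eval n (P - Q) q = 0" if "q \<in> ({1..n} \<rightarrow>\<^sub>E UNIV)" for q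
    using fun_cong[OF eq, of q] that by (simp add: slice_eval_diff)
  ultimately have "P - Q = 0" by (rule slice_poly_eq_0)
  then show "P = Q" by simp
qed

end

theory Submission
  imports Defs
begin

text \<open>
  Modulo the proposed generators, every polynomial can be reduced one monomial at a time to
  a polynomial in the first \<open>k\<close> variables of degree at most 1 in each of them: the largest
  variable \<open>q\<^sub>l\<close> of a monomial is replaced by \<open>a\<^sub>l\<close> if \<open>l > k\<close>, and \<open>q\<^sub>l\<^sup>2\<close> is replaced by a real
  linear polynomial in \<open>q\<^sub>l\<close> if \<open>l \<le> k\<close>. The generators vanish on the given set, and a reduced
  polynomial vanishing on it is zero: it has the form \<open>A + q\<^sub>1 B\<close> with \<open>A\<close>, \<open>B\<close> independent
  of \<open>q\<^sub>1\<close>, and comparing two points of the sphere with the same other coordinates gives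
  \<open>B = 0\<close>, hence \<open>A = 0\<close>.
\<close>

section \<open>Closure properties of polynomials and induction over monomials\<close>

lemma slice_polys_mono: "l \<le> n \<Longrightarrow> slice_polys l \<subseteq> slice_polys n"
  by (fastforce simp: slice_polys_def)

lemma zero_in_slice_polys: "0 \<in> slice_polys n"
  by (simp add: slice_polys_def)

lemma single_in_slice_polys: "Poly_Mapping.keys m \<subseteq> {1..n} \<Longrightarrow> Poly_Mapping.single m c \<in> slice_polys n"
  by (simp add: slice_polys_def)

lemma add_in_slice_polys: "P \<in> slice_polys n \<Longrightarrow> Q \<in> slice_polys n \<Longrightarrow> P + Q \<in> slice_polys n"
  using Poly_Mapping.keys_add[of P Q] unfolding slice_polys_def by blast

lemma poly_mapping_eq_sum_single:
  fixes P :: "'a \<Rightarrow>\<^sub>0 'b::comm_monoid_add"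
  shows "(\<Sum>m\<in>Poly_Mapping.keys P. Poly_Mapping.single m (Poly_Mapping.lookup P m)) = P"
proof (rule poly_mapping_eqI)
  fix m
  show "Poly_Mapping.lookup (\<Sum>m\<in>Poly_Mapping.keys P. Poly_Mapping.single m (Poly_Mapping.lookup P m)) m
      = Poly_Mapping.lookup P m"
    by (simp add: lookup_sum lookup_single when_def in_keys_iff)
qed

text \<open>A polynomial is the finite sum of its terms, so any property stable under addition can
  be checked on monomials. The proof adds the terms one at a time, over subsets of the keys.\<close>

lemma slice_polys_induct [consumes 1, case_names zero single add]:
  assumes P: "P \<in> slice_polys n"
    and zero: "\<phi> 0"
    and single: "\<And>m c. Poly_Mapping.keys m \<subseteq> {1..n} \<Longrightarrow> \<phi> (Poly_Mapping.single m c)"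
    and add: "\<And>P Q. \<phi> P \<Longrightarrow> \<phi> Q \<Longrightarrow> \<phi> (P + Q)"
  shows "\<phi> P"
proof -
  have "\<phi> (\<Sum>m\<in>K. Poly_Mapping.single m (Poly_Mapping.lookup P m))"
    if "K \<subseteq> Poly_Mapping.keys P" for K
    using finite_subset[OF that finite_keys] that
  proof (induction K rule: finite_induct)
    case empty
    then show ?case using zero by simp
  next
    case (insert m K)
    then have "Poly_Mapping.keys m \<subseteq> {1..n}" using P by (auto simp: slice_polys_def)
    with insert show ?case by (simp add: single add)
  qed
  from this[OF order_refl] show ?thesis
    by (simp add: poly_mapping_eq_sum_single)
qed

section \<open>Evaluation: additivity, monomials, dependence on the first variables\<close>

lemma slice_eval_0: "slice_eval n 0 q = 0"
  by (simp add: slice_eval_def)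

lemma slice_eval_add: "slice_eval n (P + Q) q = slice_eval n P q + slice_eval n Q q"
proof -
  let ?K = "Poly_Mapping.keys P \<union> Poly_Mapping.keys Q"
  have "Poly_Mapping.keys (P + Q) \<subseteq> ?K"
    by (rule Poly_Mapping.keys_add)
  then show ?thesis
    by (simp add: slice_eval_eq_sum[of ?K] lookup_add distrib_left sum.distrib)
qed

lemma slice_eval_sum: "slice_eval n (\<Sum>i\<in>I. P i) q = (\<Sum>i\<in>I. slice_eval n (P i) q)"
  by (induction I rule: infinite_finite_induct) (simp_all add: slice_eval_0 slice_eval_add)

lemma slice_eval_single:
  "slice_eval n (Poly_Mapping.single m c) q =
    prod_list (map (\<lambda>i. q i ^ Poly_Mapping.lookup m i) [1..<Suc n]) * c"
  by (simp add: slice_eval_eq_sum[of "{m}"])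

text \<open>Variables beyond \<open>k\<close> have exponent 0 and contribute only factors 1 at the
  right end of each product. This lets a remainder in the first \<open>k\<close> variables be tested
  on its own coordinates.\<close>

lemma slice_eval_cong:
  assumes "P \<in> slice_polys k" "k \<le> n" "\<And>i. i \<in> {1..k} \<Longrightarrow> q i = q' i"
  shows "slice_eval n P q = slice_eval k P q'"
  using assms(1)
proof (induction rule: slice_polys_induct)
  case (single m c)
  have "[1..<Suc n] = [1..<Suc k] @ [Suc k..<Suc n]"
    using upt_add_eq_append[of 1 "Suc k" "n - k"] assms(2) by simp
  moreover have "q i ^ Poly_Mapping.lookup m i = 1" if "i \<in> set [Suc k..<Suc n]" for i
  proof -
    have "i \<notin> Poly_Mapping.keys m" using single that by (auto simp del: upt_Suc)
    then show ?thesis by (simp add: in_keys_iff)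
  qed
  then have "map (\<lambda>i. q i ^ Poly_Mapping.lookup m i) [Suc k..<Suc n] = map (\<lambda>i. 1) [Suc k..<Suc n]"
    by (intro map_cong refl)
  moreover have "prod_list (map (\<lambda>i. 1 :: quat) xs) = 1" for xs :: "nat list"
    by (induction xs) auto
  moreover have "map (\<lambda>i. q i ^ Poly_Mapping.lookup m i) [1..<Suc k] = map (\<lambda>i. q' i ^ Poly_Mapping.lookup m i) [1..<Suc k]"
    using assms(3) by (intro map_cong refl) auto
  ultimately show ?case
    unfolding slice_eval_single by (simp only: map_append prod_list.append mult_1_right)
qed (simp_all add: slice_eval_0 slice_eval_add)

section \<open>Products of a generator with a monomial\<close>

lemma linear_times_single:
  "(slice_var l - slice_const a) * Poly_Mapping.single m c =
    Poly_Mapping.single (Poly_Mapping.single l 1 + m) c - Poly_Mapping.single m (a * c)"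
  by (simp add: slice_var_def slice_const_def left_diff_distrib mult_single)

lemma sphere_poly_times_single:
  "sphere_poly l a * Poly_Mapping.single m c =
    Poly_Mapping.single (Poly_Mapping.single l 2 + m) c
    - Poly_Mapping.single (Poly_Mapping.single l 1 + m) (of_real (2 * qRe a) * c)
    + Poly_Mapping.single m (of_real ((norm a)\<^sup>2) * c)"
  unfolding sphere_poly_def slice_var_def slice_const_def
  by (simp add: left_diff_distrib distrib_right mult_single power2_eq_square
      numeral_2_eq_2 flip: single_add)

text \<open>Since exponents add variable by variable, an extra power of \<open>q l\<close> enters in
  the middle of the ordered product, after the variables below \<open>l\<close>. Their product
  \<open>X\<close> is the same for all \<open>j\<close>, so the terms of a generator times a
  monomial can be compared.\<close>

lemma monomial_split:
  fixes q :: "nat \<Rightarrow> quat"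
  assumes "l \<in> {1..n}"
  obtains X where
    "\<And>j. prod_list (map (\<lambda>i. q i ^ Poly_Mapping.lookup (Poly_Mapping.single l j + m) i) [1..<Suc n]) =
      X * q l ^ j * q l ^ Poly_Mapping.lookup m l
        * prod_list (map (\<lambda>i. q i ^ Poly_Mapping.lookup m i) [Suc l..<Suc n])"
proof
  fix j
  have "[1..<Suc n] = [1..<l] @ l # [Suc l..<Suc n]"
    using assms upt_add_eq_append[of 1 l "Suc n - l"] by (simp add: upt_conv_Cons)
  moreover have "map (\<lambda>i. q i ^ Poly_Mapping.lookup (Poly_Mapping.single l j + m) i) [1..<l]
      = map (\<lambda>i. q i ^ Poly_Mapping.lookup m i) [1..<l]"
    by (intro map_cong refl) (auto simp: lookup_add lookup_single)
  moreover have "map (\<lambda>i. q i ^ Poly_Mapping.lookup (Poly_Mapping.single l j + m) i) [Suc l..<Suc n]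
      = map (\<lambda>i. q i ^ Poly_Mapping.lookup m i) [Suc l..<Suc n]"
    by (intro map_cong refl) (auto simp: lookup_add lookup_single)
  ultimately show "prod_list (map (\<lambda>i. q i ^ Poly_Mapping.lookup (Poly_Mapping.single l j + m) i) [1..<Suc n]) =
      prod_list (map (\<lambda>i. q i ^ Poly_Mapping.lookup m i) [1..<l]) * q l ^ j * q l ^ Poly_Mapping.lookup m l
        * prod_list (map (\<lambda>i. q i ^ Poly_Mapping.lookup m i) [Suc l..<Suc n])"
    by (simp only: map_append list.map prod_list.append prod_list.Cons lookup_add lookup_single_eq
        power_add mult.assoc)
qed

text \<open>In the first term the new factor \<open>q l\<close> stands among the powers of
  \<open>q l\<close>; in the second, the constant \<open>q l\<close> stands behind all variables,
  just before the coefficient. The values cancel once \<open>q l\<close> commutes with the later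
  variables that can occur in \<open>Q\<close>. The bound \<open>N\<close> covers two uses:
  \<open>N = l\<close> leaves no later variable, and \<open>N = n\<close> allows all of
  them.\<close>

lemma slice_eval_linear_times:
  assumes "l \<in> {1..n}" "Q \<in> slice_polys N"
    and comm: "\<And>i. l < i \<Longrightarrow> i \<le> N \<Longrightarrow> q i * q l = q l * q i"
  shows "slice_eval n ((slice_var l - slice_const (q l)) * Q) q = 0"
  using assms(2)
proof (induction rule: slice_polys_induct)
  case (single m c)
  obtain X where X: "\<And>j. prod_list (map (\<lambda>i. q i ^ Poly_Mapping.lookup (Poly_Mapping.single l j + m) i) [1..<Suc n]) =
      X * q l ^ j * q l ^ Poly_Mapping.lookup m l
        * prod_list (map (\<lambda>i. q i ^ Poly_Mapping.lookup m i) [Suc l..<Suc n])"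
    using monomial_split[OF assms(1)] by blast
  let ?Y = "\<lambda>xs. prod_list (map (\<lambda>i. q i ^ Poly_Mapping.lookup m i) xs)"
  \<comment> \<open>Moves \<open>q l\<close> past the later factors one by one: up to
    \<open>N\<close> by \<open>comm\<close>, beyond \<open>N\<close> because the exponent is
    0.\<close>
  have "?Y xs * q l = q l * ?Y xs" if "set xs \<subseteq> {l<..}" for xs
    using that
  proof (induction xs)
    case (Cons i xs)
    have "q i ^ Poly_Mapping.lookup m i * q l = q l * q i ^ Poly_Mapping.lookup m i"
    proof (cases "i \<le> N")
      case True
      then show ?thesis using comm[of i] Cons.prems by (simp add: power_commuting_commutes)
    next
      case False
      then have "i \<notin> Poly_Mapping.keys m" using single by auto
      then show ?thesis by (simp add: in_keys_iff)
    qed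
    with Cons show ?case by simp (metis mult.assoc)
  qed simp
  from this[of "[Suc l..<Suc n]"]
  have Y: "?Y [Suc l..<Suc n] * q l = q l * ?Y [Suc l..<Suc n]"
    by (simp add: subset_iff del: upt_Suc)
  have "slice_eval n ((slice_var l - slice_const (q l)) * Poly_Mapping.single m c) q
      = X * (q l * q l ^ Poly_Mapping.lookup m l) * ?Y [Suc l..<Suc n] * c
        - X * q l ^ Poly_Mapping.lookup m l * (?Y [Suc l..<Suc n] * q l) * c"
    using X[of 0] X[of 1]
    by (simp add: linear_times_single slice_eval_diff slice_eval_single mult.assoc del: upt_Suc)
  also have "\<dots> = 0"
    unfolding Y power_commutes[symmetric] by (simp only: mult.assoc diff_self)
  finally show ?case .
qed (simp_all add: slice_eval_0 slice_eval_add distrib_left)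

section \<open>Spheres and their quadratic polynomials\<close>

lemma norm_sq_qRe_qIm: "(norm a)\<^sup>2 = (qRe a)\<^sup>2 + (norm (qIm a))\<^sup>2"
  unfolding power2_norm_eq_inner qIm_def
  by (simp add: inner_quat_def minus_quat_def of_real_def scaleR_quat_def one_quat_def power2_eq_square)

text \<open>With \<open>x = r + J s\<close> and \<open>J * J = -1\<close>, the square of
  \<open>x - r\<close> is \<open>- s\<^sup>2\<close>. As the real part \<open>r\<close> is central,
  this expands to the quadratic equation, whose constant term is
  \<open>r\<^sup>2 + s\<^sup>2 = (norm a)\<^sup>2\<close>.\<close>

lemma sphere_of_root:
  assumes "x \<in> sphere_of a"
  shows "x\<^sup>2 - x * of_real (2 * qRe a) + of_real ((norm a)\<^sup>2) = 0"
proof -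
  obtain J where x: "x = of_real (qRe a) + J * of_real (norm (qIm a))" and J: "J * J = -1"
    using assms by (auto simp: sphere_of_def imag_units_def power2_eq_square)
  define r s where "r = qRe a" and "s = norm (qIm a)"
  define R :: quat where "R = of_real r"
  have R: "R * x = x * R"
    by (simp add: R_def of_real_def)
  have "x - R = s *\<^sub>R J"
    unfolding x R_def r_def s_def by (simp add: of_real_def)
  then have "(x - R) * (x - R) = - of_real (s\<^sup>2)"
    by (simp add: J of_real_def power2_eq_square)
  moreover have "(x - R) * (x - R) = x * x - (x * R + x * R) + R * R"
    by (simp add: left_diff_distrib right_diff_distrib R)
  moreover have "x * of_real (2 * r) = x * R + x * R"
    unfolding R_def mult_2 of_real_add by (rule distrib_left)
  ultimately have "x * x - x * of_real (2 * r) + R * R = - of_real (s\<^sup>2)"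
    by (simp only:)
  then show ?thesis
    unfolding norm_sq_qRe_qIm r_def[symmetric] s_def[symmetric] of_real_add add.assoc[symmetric]
    by (simp add: R_def power2_eq_square)
qed

text \<open>The imaginary units \<open>i\<close> and \<open>-i\<close> give points that differ
  because the radius \<open>norm (qIm a)\<close> is nonzero for nonreal \<open>a\<close>.\<close>

lemma sphere_of_two_points:
  assumes "a \<notin> \<real>"
  obtains x y where "x \<in> sphere_of a" "y \<in> sphere_of a" "x \<noteq> y"
proof
  let ?i = "Quat 0 1 0 0"
  let ?s = "of_real (norm (qIm a)) :: quat"
  have i: "?i \<in> imag_units" "- ?i \<in> imag_units"
    by (simp_all add: imag_units_def power2_eq_square times_quat_def uminus_quat_def one_quat_def)
  show "of_real (qRe a) + ?i * ?s \<in> sphere_of a" "of_real (qRe a) + (- ?i) * ?s \<in> sphere_of a"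
    using i unfolding sphere_of_def by blast+
  have "qIm a \<noteq> 0"
    using assms unfolding qIm_def by (metis Reals_of_real eq_iff_diff_eq_0)
  moreover have "?i \<noteq> - ?i"
    by (simp add: uminus_quat_def)
  ultimately show "of_real (qRe a) + ?i * ?s \<noteq> of_real (qRe a) + (- ?i) * ?s"
    by (metis add_left_cancel mult_cancel_right norm_eq_zero of_real_eq_0_iff)
qed

text \<open>The coefficients of \<open>sphere_poly l a\<close> are real, hence central, so they can
  be collected next to the powers of \<open>q l\<close>. The value then contains the quadratic
  polynomial at \<open>q l\<close> as a factor, which is 0 by \<open>sphere_of_root\<close>.\<close>

lemma slice_eval_sphere_poly_times:
  assumes "l \<in> {1..n}" "Q \<in> slice_polys n" "q l \<in> sphere_of a"
  shows "slice_eval n (sphere_poly l a * Q) q = 0"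
  using assms(2)
proof (induction rule: slice_polys_induct)
  case (single m c)
  obtain X where X: "\<And>j. prod_list (map (\<lambda>i. q i ^ Poly_Mapping.lookup (Poly_Mapping.single l j + m) i) [1..<Suc n]) =
      X * q l ^ j * q l ^ Poly_Mapping.lookup m l
        * prod_list (map (\<lambda>i. q i ^ Poly_Mapping.lookup m i) [Suc l..<Suc n])"
    using monomial_split[OF assms(1)] by blast
  let ?Y = "q l ^ Poly_Mapping.lookup m l * prod_list (map (\<lambda>i. q i ^ Poly_Mapping.lookup m i) [Suc l..<Suc n]) * c"
  have X0: "prod_list (map (\<lambda>i. q i ^ Poly_Mapping.lookup m i) [1..<Suc n]) * c = X * ?Y"
    using X[of 0] by (simp add: mult.assoc del: upt_Suc)
  have real: "z * (of_real r * c) = of_real r * (z * c)" for z :: quat and r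
    by (simp add: of_real_def)
  have "slice_eval n (sphere_poly l a * Poly_Mapping.single m c) q
      = X * ((q l)\<^sup>2 - q l * of_real (2 * qRe a) + of_real ((norm a)\<^sup>2)) * ?Y"
    unfolding sphere_poly_times_single slice_eval_add slice_eval_diff slice_eval_single real X X0
    by (simp only: of_real_def mult_scaleR_left mult_scaleR_right mult_1_left mult_1_right
        distrib_left distrib_right left_diff_distrib right_diff_distrib mult.assoc power_one_right)
  then show ?case
    by (simp only: sphere_of_root[OF assms(3)] mult_zero_left mult_zero_right)
qed (simp_all add: slice_eval_0 slice_eval_add distrib_left)

section \<open>Combinations of the generators\<close>

definition slice_comb :: "nat \<Rightarrow> nat \<Rightarrow> (nat \<Rightarrow> quat) \<Rightarrow> (nat \<Rightarrow> slice_poly) \<Rightarrow> slice_poly" where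
  "slice_comb k n a Q = (\<Sum>l=1..k. sphere_poly l (a l) * Q l)
     + (\<Sum>l=k+1..n. (slice_var l - slice_const (a l)) * Q l)"

lemma slice_comb_add: "slice_comb k n a (\<lambda>l. Q l + Q' l) = slice_comb k n a Q + slice_comb k n a Q'"
  by (simp add: slice_comb_def distrib_left sum.distrib)

lemma slice_comb_0: "slice_comb k n a (\<lambda>l. 0) = 0"
  by (simp add: slice_comb_def)

lemma slice_comb_single_variable:
  "slice_comb k n a (\<lambda>i. if i = l then Q else 0) =
    (if l \<in> {1..k} then sphere_poly l (a l) * Q else 0)
    + (if l \<in> {k+1..n} then (slice_var l - slice_const (a l)) * Q else 0)"
  by (simp add: slice_comb_def if_distrib[of "\<lambda>x. _ * x"] cong: if_cong)

text \<open>Every summand vanishes by the two preceding evaluation lemmas. The bound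
  \<open>N l\<close> on the variables of the cofactor \<open>Q l\<close> makes this serve the
  converse directions of both equivalences; the condition \<open>i \<le> n\<close> ensures that the
  later coordinate \<open>q i\<close> is \<open>a i\<close>.\<close>

lemma slice_eval_slice_comb:
  assumes q: "q \<in> spheres_points k n a" and "k \<le> n"
    and sph: "\<And>l. l \<in> {1..k} \<Longrightarrow> Q l \<in> slice_polys n"
    and lin: "\<And>l. l \<in> {k+1..n} \<Longrightarrow> Q l \<in> slice_polys (N l)"
    and comm: "\<And>l i. l \<in> {k+1..n} \<Longrightarrow> l < i \<Longrightarrow> i \<le> N l \<Longrightarrow> i \<le> n \<and> a i * a l = a l * a i"
  shows "slice_eval n (slice_comb k n a Q) q = 0"
proof -
  have qs: "q l \<in> sphere_of (a l)" if "l \<in> {1..k}" for l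
    using PiE_mem[OF q[unfolded spheres_points_def], of l] that \<open>k \<le> n\<close> by simp
  have qa: "q l = a l" if "l \<in> {k+1..n}" for l
    using PiE_mem[OF q[unfolded spheres_points_def], of l] that by simp
  have "slice_eval n (sphere_poly l (a l) * Q l) q = 0" if "l \<in> {1..k}" for l
    using that \<open>k \<le> n\<close> by (intro slice_eval_sphere_poly_times sph qs) auto
  moreover have "slice_eval n ((slice_var l - slice_const (a l)) * Q l) q = 0" if l: "l \<in> {k+1..n}" for l
  proof -
    have "slice_eval n ((slice_var l - slice_const (q l)) * Q l) q = 0"
    proof (rule slice_eval_linear_times[OF _ lin[OF l]])
      show "l \<in> {1..n}" using l by auto
      show "q i * q l = q l * q i" if "l < i" "i \<le> N l" for i
        using comm[OF l that] qa[OF l] qa[of i] that l by auto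
    qed
    then show ?thesis using qa[OF l] by simp
  qed
  ultimately show ?thesis
    by (simp add: slice_comb_def slice_eval_add slice_eval_sum)
qed

section \<open>Reduction modulo the generators\<close>

definition slice_reduced :: "nat \<Rightarrow> slice_poly set" where
  "slice_reduced k = {R \<in> slice_polys k. \<forall>m\<in>Poly_Mapping.keys R. \<forall>i. Poly_Mapping.lookup m i \<le> 1}"

lemma zero_in_slice_reduced: "0 \<in> slice_reduced k"
  by (simp add: slice_reduced_def zero_in_slice_polys)

lemma add_in_slice_reduced: "P \<in> slice_reduced n \<Longrightarrow> Q \<in> slice_reduced n \<Longrightarrow> P + Q \<in> slice_reduced n"
  using Poly_Mapping.keys_add[of P Q] add_in_slice_polys unfolding slice_reduced_def by blast

text \<open>Division with remainder by the generators. For \<open>l > k\<close> the cofactors are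
  confined to \<open>slice_polys l\<close>, the stricter of the two conditions in the theorem, so
  that one reduction serves both representations.\<close>

definition slice_reducible :: "nat \<Rightarrow> nat \<Rightarrow> (nat \<Rightarrow> quat) \<Rightarrow> slice_poly \<Rightarrow> bool" where
  "slice_reducible k n a P \<longleftrightarrow> (\<exists>Q. \<exists>R\<in>slice_reduced k.
     (\<forall>l\<in>{1..k}. Q l \<in> slice_polys n) \<and> (\<forall>l\<in>{k+1..n}. Q l \<in> slice_polys l) \<and>
     P = slice_comb k n a Q + R)"

lemma slice_reducible_reduced: "P \<in> slice_reduced k \<Longrightarrow> slice_reducible k n a P"
  unfolding slice_reducible_def
  by (intro exI[of _ "\<lambda>l. 0"] bexI[of _ P]) (simp_all add: slice_comb_0 zero_in_slice_polys)

lemma slice_reducible_add: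
  assumes "slice_reducible k n a P" "slice_reducible k n a P'"
  shows "slice_reducible k n a (P + P')"
proof -
  obtain Q R Q' R' where "R \<in> slice_reduced k" "R' \<in> slice_reduced k"
    "\<forall>l\<in>{1..k}. Q l \<in> slice_polys n" "\<forall>l\<in>{k+1..n}. Q l \<in> slice_polys l"
    "\<forall>l\<in>{1..k}. Q' l \<in> slice_polys n" "\<forall>l\<in>{k+1..n}. Q' l \<in> slice_polys l"
    "P = slice_comb k n a Q + R" "P' = slice_comb k n a Q' + R'"
    using assms unfolding slice_reducible_def by blast
  then show ?thesis
    unfolding slice_reducible_def
    by (intro exI[of _ "\<lambda>l. Q l + Q' l"] bexI[of _ "R + R'"])
      (auto simp: slice_comb_add add_in_slice_polys add_in_slice_reduced)
qed

lemma slice_reducible_sphere_poly_times: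
  assumes "l \<in> {1..k}" "k \<le> n" "Q \<in> slice_polys n"
  shows "slice_reducible k n a (sphere_poly l (a l) * Q)"
  unfolding slice_reducible_def
  using assms by (intro exI[of _ "\<lambda>i. if i = l then Q else 0"] bexI[of _ 0])
    (simp_all add: slice_comb_single_variable zero_in_slice_polys zero_in_slice_reduced)

lemma slice_reducible_linear_times:
  assumes "l \<in> {k+1..n}" "Q \<in> slice_polys l"
  shows "slice_reducible k n a ((slice_var l - slice_const (a l)) * Q)"
  unfolding slice_reducible_def
  using assms by (intro exI[of _ "\<lambda>i. if i = l then Q else 0"] bexI[of _ 0])
    (auto simp: slice_comb_single_variable zero_in_slice_polys zero_in_slice_reduced)

text \<open>The sum is the total degree of a monomial, the measure that decreases in the
  reduction.\<close>

lemma sum_lookup_single_add: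
  fixes l n :: nat
  assumes "l \<in> {1..n}"
  shows "(\<Sum>i=1..n. Poly_Mapping.lookup (Poly_Mapping.single l j + m) i) = j + (\<Sum>i=1..n. Poly_Mapping.lookup m i)"
  unfolding lookup_add lookup_single when_def sum.distrib sum.delta'[OF finite_atLeastAtMost]
  using assms by simp

lemma exponent_split:
  fixes m :: "nat \<Rightarrow>\<^sub>0 nat"
  assumes "j \<le> Poly_Mapping.lookup m l"
  obtains m' where "m = Poly_Mapping.single l j + m'" "Poly_Mapping.keys m' \<subseteq> Poly_Mapping.keys m"
proof
  show "m = Poly_Mapping.single l j + (m - Poly_Mapping.single l j)"
    by (rule poly_mapping_eqI) (use assms in \<open>auto simp: lookup_add lookup_minus lookup_single when_def\<close>)
  show "Poly_Mapping.keys (m - Poly_Mapping.single l j) \<subseteq> Poly_Mapping.keys m"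
    by (auto simp: in_keys_iff lookup_minus)
qed

text \<open>Induction on the total degree: an irreducible monomial is already in
  \<open>slice_reduced k\<close>, and any other is a multiple of a generator plus monomials of
  smaller degree.\<close>

lemma slice_reducible_single:
  assumes "k \<le> n" "Poly_Mapping.keys m \<subseteq> {1..n}"
  shows "slice_reducible k n a (Poly_Mapping.single m c)"
  using assms(2)
proof (induction "\<Sum>i=1..n. Poly_Mapping.lookup m i" arbitrary: m c rule: less_induct)
  case less
  consider (linear) "\<not> Poly_Mapping.keys m \<subseteq> {1..k}"
    | (square) l where "Poly_Mapping.keys m \<subseteq> {1..k}" "Poly_Mapping.lookup m l > 1"
    | (reduced) "Poly_Mapping.keys m \<subseteq> {1..k}" "\<And>l. Poly_Mapping.lookup m l \<le> 1"
    by (meson not_le)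
  then show ?case
  proof cases
    case linear
    \<comment> \<open>Taking the largest variable places the cofactor in
      \<open>slice_polys l\<close>, as required for \<open>l > k\<close>.\<close>
    define l where "l = Max (Poly_Mapping.keys m)"
    have ne: "Poly_Mapping.keys m \<noteq> {}" using linear by auto
    have l: "l \<in> Poly_Mapping.keys m" "Poly_Mapping.keys m \<subseteq> {1..l}"
      using ne less.prems by (auto simp: l_def)
    with linear less.prems have ln: "l \<in> {k+1..n}" by force
    obtain m' where m': "m = Poly_Mapping.single l 1 + m'" "Poly_Mapping.keys m' \<subseteq> Poly_Mapping.keys m"
      using exponent_split[of 1 m l] l(1) by (auto simp: in_keys_iff Suc_le_eq)
    \<comment> \<open>One factor \<open>q\<^sub>l\<close> is traded for the constant
      \<open>a l\<close>, which multiplies the coefficient from the left; the degree drops by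
      1.\<close>
    have eq: "Poly_Mapping.single m c = (slice_var l - slice_const (a l)) * Poly_Mapping.single m' c
        + Poly_Mapping.single m' (a l * c)"
      by (simp add: linear_times_single m'(1))
    have "slice_reducible k n a (Poly_Mapping.single m' (a l * c))"
      using sum_lookup_single_add[of l n 1 m', folded m'(1)] ln m'(2) less.prems
      by (intro less.hyps) auto
    moreover have "slice_reducible k n a ((slice_var l - slice_const (a l)) * Poly_Mapping.single m' c)"
      using m'(2) l by (intro slice_reducible_linear_times ln single_in_slice_polys) auto
    ultimately show ?thesis
      unfolding eq by (intro slice_reducible_add)
  next
    case square
    then have l: "l \<in> {1..k}"
      by (metis in_keys_iff not_one_less_zero subsetD)
    obtain m' where m': "m = Poly_Mapping.single l 2 + m'" "Poly_Mapping.keys m' \<subseteq> Poly_Mapping.keys m"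
      using exponent_split[of 2 m l] square(2) by auto
    let ?m = "Poly_Mapping.single l 1 + m'"
    \<comment> \<open>This is \<open>sphere_poly_times_single\<close> solved for its leading term;
      the two remaining monomials have degree lower by 1 and by 2.\<close>
    have eq: "Poly_Mapping.single m c = sphere_poly l (a l) * Poly_Mapping.single m' c
        + Poly_Mapping.single ?m (of_real (2 * qRe (a l)) * c)
        + Poly_Mapping.single m' (- of_real ((norm (a l))\<^sup>2) * c)"
      by (simp add: sphere_poly_times_single m'(1) single_uminus)
    have ln: "l \<in> {1..n}" using l assms(1) by auto
    have km: "Poly_Mapping.keys ?m \<subseteq> {1..n}"
      using Poly_Mapping.keys_add[of "Poly_Mapping.single l 1" m'] m'(2) less.prems ln by fastforce
    have "slice_reducible k n a (Poly_Mapping.single ?m c')" for c'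
      using sum_lookup_single_add[OF ln, of 2 m', folded m'(1)] sum_lookup_single_add[OF ln, of 1 m'] km
      by (intro less.hyps) simp_all
    moreover have "slice_reducible k n a (Poly_Mapping.single m' c')" for c'
      using sum_lookup_single_add[OF ln, of 2 m', folded m'(1)] m'(2) less.prems
      by (intro less.hyps) auto
    moreover have "slice_reducible k n a (sphere_poly l (a l) * Poly_Mapping.single m' c)"
      using m'(2) less.prems by (intro slice_reducible_sphere_poly_times l assms(1) single_in_slice_polys) auto
    ultimately show ?thesis
      unfolding eq by (intro slice_reducible_add)
  next
    case reduced
    then show ?thesis
      by (intro slice_reducible_reduced) (simp add: slice_reduced_def single_in_slice_polys)
  qed
qed

lemma slice_polys_reducible:
  assumes "k \<le> n" "P \<in> slice_polys n"
  shows "slice_reducible k n a P"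
  using assms(2)
  by (induction rule: slice_polys_induct)
    (simp_all add: slice_reducible_reduced zero_in_slice_reduced slice_reducible_single assms(1) slice_reducible_add)

section \<open>Reduced polynomials vanishing on products of spheres\<close>

text \<open>Induction on the list of variables. Grouping the monomials by the exponent 0 or 1 of the
  first variable writes the sum as \<open>F 0 q + x * F 1 q\<close>, and two distinct values of
  \<open>x\<close> force both parts to vanish. Splitting off the leftmost variable is what avoids
  any commutation.\<close>

lemma multilinear_monomials_independent:
  fixes c :: "(nat \<Rightarrow>\<^sub>0 nat) \<Rightarrow> quat" and T :: "nat \<Rightarrow> quat set"
  assumes "finite K" "distinct xs"
    and "\<And>i. i \<in> set xs \<Longrightarrow> \<exists>x\<in>T i. \<exists>y\<in>T i. x \<noteq> y"
    and "\<And>m i. m \<in> K \<Longrightarrow> i \<in> set xs \<Longrightarrow> Poly_Mapping.lookup m i \<le> 1"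
    and "\<And>l m. \<lbrakk>l \<in> K; m \<in> K; \<And>i. i \<in> set xs \<Longrightarrow> Poly_Mapping.lookup l i = Poly_Mapping.lookup m i\<rbrakk> \<Longrightarrow> l = m"
    and "\<And>q. (\<And>i. i \<in> set xs \<Longrightarrow> q i \<in> T i) \<Longrightarrow>
      (\<Sum>m\<in>K. prod_list (map (\<lambda>i. q i ^ Poly_Mapping.lookup m i) xs) * c m) = 0"
    and "m \<in> K"
  shows "c m = 0"
  using assms
proof (induction xs arbitrary: K m)
  case Nil
  \<comment> \<open>With no variables left, the separation hypothesis identifies all elements of
    \<open>K\<close>, and the vanishing sum is \<open>c m\<close> itself.\<close>
  then have "K = {m}" by auto
  with Nil.prems(6) show ?case by simp
next
  case (Cons j xs)
  define K' where "K' e = {l \<in> K. Poly_Mapping.lookup l j = e}" for e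
  define F where "F e q = (\<Sum>l\<in>K' e. prod_list (map (\<lambda>i. q i ^ Poly_Mapping.lookup l i) xs) * c l)" for e q
  have K: "K = K' 0 \<union> K' 1"
    using Cons.prems(4)[of _ j] by (force simp: K'_def)
  have fin: "finite (K' e)" for e
    using Cons.prems(1) by (simp add: K'_def)
  have F: "F 0 q = 0 \<and> F 1 q = 0" if q: "\<And>i. i \<in> set xs \<Longrightarrow> q i \<in> T i" for q
  proof -
    \<comment> \<open>As \<open>j\<close> does not occur in \<open>xs\<close>, \<open>F e\<close>
      does not depend on \<open>q j\<close>; the power of \<open>x\<close> is the leftmost factor
      and comes out of the sum.\<close>
    have eq: "F 0 q + x * F 1 q = 0" if "x \<in> T j" for x
    proof -
      have F_upd: "F e (q(j := x)) = F e q" for e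
        unfolding F_def using Cons.prems(2)
        by (intro sum.cong refl arg_cong2[of _ _ _ _ "(*)"] arg_cong[of _ _ prod_list] map_cong) auto
      have sum_K': "(\<Sum>l\<in>K' e. prod_list (map (\<lambda>i. (q(j := x)) i ^ Poly_Mapping.lookup l i) (j # xs)) * c l)
          = x ^ e * F e (q(j := x))" for e
        unfolding F_def sum_distrib_left
        by (intro sum.cong refl) (simp add: K'_def mult.assoc)
      have "0 = (\<Sum>l\<in>K' 0 \<union> K' 1. prod_list (map (\<lambda>i. (q(j := x)) i ^ Poly_Mapping.lookup l i) (j # xs)) * c l)"
        unfolding K[symmetric] by (rule Cons.prems(6)[symmetric]) (use q that in auto)
      also have "\<dots> = x ^ 0 * F 0 (q(j := x)) + x ^ 1 * F 1 (q(j := x))"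
        unfolding sum_K'[symmetric] by (rule sum.union_disjoint) (use fin in \<open>auto simp: K'_def\<close>)
      finally show ?thesis by (simp add: F_upd)
    qed
    obtain x y where xy: "x \<in> T j" "y \<in> T j" "x \<noteq> y"
      using Cons.prems(3)[of j] by auto
    \<comment> \<open>Subtracting the equations for two points eliminates \<open>F 0 q\<close>; the
      quaternions have no zero divisors, so \<open>F 1 q = 0\<close>.\<close>
    have "(x - y) * F 1 q = (F 0 q + x * F 1 q) - (F 0 q + y * F 1 q)"
      by (simp add: left_diff_distrib)
    also have "\<dots> = 0" using eq xy by simp
    finally have "F 1 q = 0" using xy by simp
    with eq[OF xy(1)] show ?thesis by simp
  qed
  define e where "e = Poly_Mapping.lookup m j"
  have "e \<in> {0, 1}" using Cons.prems(4)[of m j] Cons.prems(7) by (auto simp: e_def)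
  show ?case
  proof (rule Cons.IH[of "K' e"])
    show "m \<in> K' e" using Cons.prems(7) by (simp add: K'_def e_def)
    show "(\<Sum>m\<in>K' e. prod_list (map (\<lambda>i. q i ^ Poly_Mapping.lookup m i) xs) * c m) = 0"
      if "\<And>i. i \<in> set xs \<Longrightarrow> q i \<in> T i" for q
      using F[OF that] \<open>e \<in> {0, 1}\<close> by (auto simp: F_def)
    show "l = l'" if "l \<in> K' e" "l' \<in> K' e"
      "\<And>i. i \<in> set xs \<Longrightarrow> Poly_Mapping.lookup l i = Poly_Mapping.lookup l' i" for l l'
      using that by (intro Cons.prems(5)) (auto simp: K'_def)
  qed (use Cons.prems fin in \<open>auto simp: K'_def\<close>)
qed

text \<open>Each sphere of a nonreal \<open>a l\<close> has two distinct points, so independence of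
  multilinear monomials applies with these spheres as value sets.\<close>

lemma slice_reduced_eq_0:
  assumes R: "R \<in> slice_reduced k"
    and "k \<le> n" and a: "\<forall>l\<in>{1..k}. a l \<notin> \<real>"
    and zero: "\<And>q. q \<in> spheres_points k n a \<Longrightarrow> slice_eval n R q = 0"
  shows "R = 0"
proof -
  let ?K = "Poly_Mapping.keys R"
  have Rk: "R \<in> slice_polys k" using R by (simp add: slice_reduced_def)
  have "Poly_Mapping.lookup R m = 0" if m: "m \<in> ?K" for m
  proof (rule multilinear_monomials_independent[where T = "\<lambda>i. sphere_of (a i)" and xs = "[1..<Suc k]", OF _ _ _ _ _ _ m])
    show "\<exists>x\<in>sphere_of (a i). \<exists>y\<in>sphere_of (a i). x \<noteq> y" if "i \<in> set [1..<Suc k]" for i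
      using that a sphere_of_two_points[of "a i"] by (metis atLeastLessThanSuc_atLeastAtMost set_upt)
    show "Poly_Mapping.lookup m i \<le> 1" if "m \<in> ?K" for m i
      using R that by (auto simp: slice_reduced_def)
    fix l m :: "nat \<Rightarrow>\<^sub>0 nat"
    assume lm: "l \<in> ?K" "m \<in> ?K" "\<And>i. i \<in> set [1..<Suc k] \<Longrightarrow> Poly_Mapping.lookup l i = Poly_Mapping.lookup m i"
    show "l = m"
    proof (rule poly_mapping_eqI)
      fix i
      have "Poly_Mapping.keys l \<subseteq> {1..k}" "Poly_Mapping.keys m \<subseteq> {1..k}"
        using Rk lm by (auto simp: slice_polys_def)
      then have "i \<notin> {1..k} \<Longrightarrow> i \<notin> Poly_Mapping.keys l \<and> i \<notin> Poly_Mapping.keys m"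
        by blast
      then show "Poly_Mapping.lookup l i = Poly_Mapping.lookup m i"
        using lm(3)[of i] by (metis atLeastLessThanSuc_atLeastAtMost in_keys_iff set_upt)
    qed
  next
    fix q :: "nat \<Rightarrow> quat"
    assume q: "\<And>i. i \<in> set [1..<Suc k] \<Longrightarrow> q i \<in> sphere_of (a i)"
    \<comment> \<open>Completes an arbitrary choice on the first \<open>k\<close> spheres by the
      fixed coordinates; \<open>restrict\<close> is there because \<open>spheres_points\<close>
      consists of extensional functions.\<close>
    let ?q = "restrict (\<lambda>l. if l \<le> k then q l else a l) {1..n}"
    have "?q \<in> spheres_points k n a"
      using q by (auto simp: spheres_points_def simp del: upt_Suc)
    then have "slice_eval n R ?q = 0" by (rule zero)
    moreover have "slice_eval n R ?q = slice_eval k R q"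
      using Rk \<open>k \<le> n\<close> by (intro slice_eval_cong) auto
    ultimately show "(\<Sum>m\<in>?K. prod_list (map (\<lambda>i. q i ^ Poly_Mapping.lookup m i) [1..<Suc k]) * Poly_Mapping.lookup R m) = 0"
      by (simp add: slice_eval_def)
  qed auto
  then show ?thesis
    by (metis in_keys_iff lookup_zero poly_mapping_eqI)
qed

section \<open>The two equivalences\<close>

theorem proposition3p6:
  fixes n k :: nat and a :: "nat \<Rightarrow> quat" and P :: slice_poly
  assumes "1 \<le> k" and "k \<le> n"
    and "\<forall>l\<in>{1..k}. a l \<notin> \<real>"
    and "P \<in> slice_polys n"
  shows "((\<forall>q \<in> spheres_points k n a. slice_eval n P q = 0) \<longleftrightarrow>
      (\<exists>Q :: nat \<Rightarrow> slice_poly.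
        (\<forall>l\<in>{1..k}. Q l \<in> slice_polys n) \<and> (\<forall>l\<in>{k+1..n}. Q l \<in> slice_polys l) \<and>
        P = (\<Sum>l=1..k. sphere_poly l (a l) * Q l)
          + (\<Sum>l=k+1..n. (slice_var l - slice_const (a l)) * Q l)))
    \<and> ((\<forall>l\<in>{k+1..n}. \<forall>m\<in>{k+1..n}. a l * a m = a m * a l) \<longrightarrow>
      ((\<forall>q \<in> spheres_points k n a. slice_eval n P q = 0) \<longleftrightarrow>
        (\<exists>Q :: nat \<Rightarrow> slice_poly.
          (\<forall>l\<in>{1..n}. Q l \<in> slice_polys n) \<and>
          P = (\<Sum>l=1..k. sphere_poly l (a l) * Q l)
            + (\<Sum>l=k+1..n. (slice_var l - slice_const (a l)) * Q l))))"
  unfolding slice_comb_def[symmetric]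
proof (intro conjI impI iffI)
  \<comment> \<open>The forward directions of both equivalences are settled together: the cofactors
    found satisfy the stricter membership, and \<open>slice_polys_mono\<close> gives the weaker
    one.\<close>
  assume van: "\<forall>q \<in> spheres_points k n a. slice_eval n P q = 0"
  obtain Q R where R: "R \<in> slice_reduced k"
    and Q: "\<forall>l\<in>{1..k}. Q l \<in> slice_polys n" "\<forall>l\<in>{k+1..n}. Q l \<in> slice_polys l"
    and P: "P = slice_comb k n a Q + R"
    using slice_polys_reducible[OF assms(2,4)] unfolding slice_reducible_def by blast
  have "slice_eval n R q = 0" if q: "q \<in> spheres_points k n a" for q
  proof -
    have "slice_eval n (slice_comb k n a Q) q = 0"
      using Q by (intro slice_eval_slice_comb[OF q assms(2), where N = "\<lambda>l. l"]) auto
    with bspec[OF van q] show ?thesis by (simp add: P slice_eval_add)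
  qed
  then have "R = 0"
    by (rule slice_reduced_eq_0[OF R assms(2,3)])
  with P have P: "P = slice_comb k n a Q" by simp
  then show "\<exists>Q. (\<forall>l\<in>{1..k}. Q l \<in> slice_polys n) \<and> (\<forall>l\<in>{k+1..n}. Q l \<in> slice_polys l) \<and>
      P = slice_comb k n a Q"
    using Q by blast
  have "\<forall>l\<in>{1..n}. Q l \<in> slice_polys n"
  proof
    fix l assume "l \<in> {1..n}"
    then show "Q l \<in> slice_polys n"
      using Q slice_polys_mono[of l n] by (cases "l \<le> k") auto
  qed
  with P show "\<exists>Q. (\<forall>l\<in>{1..n}. Q l \<in> slice_polys n) \<and> P = slice_comb k n a Q" by blast
next
  assume "\<exists>Q. (\<forall>l\<in>{1..k}. Q l \<in> slice_polys n) \<and> (\<forall>l\<in>{k+1..n}. Q l \<in> slice_polys l) \<and>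
      P = slice_comb k n a Q"
  then show "\<forall>q \<in> spheres_points k n a. slice_eval n P q = 0"
    using slice_eval_slice_comb[OF _ assms(2), where N = "\<lambda>l. l"] by fastforce
next
  assume comm: "\<forall>l\<in>{k+1..n}. \<forall>m\<in>{k+1..n}. a l * a m = a m * a l"
    and "\<exists>Q. (\<forall>l\<in>{1..n}. Q l \<in> slice_polys n) \<and> P = slice_comb k n a Q"
  then obtain Q where Q: "\<forall>l\<in>{1..n}. Q l \<in> slice_polys n" "P = slice_comb k n a Q" by blast
  \<comment> \<open>Here the cofactors may contain all later variables, so \<open>N\<close> is
    constantly \<open>n\<close>, and \<open>comm\<close> supplies the commutation of
    \<open>a l\<close> with each later \<open>a i\<close>.\<close>
  show "\<forall>q \<in> spheres_points k n a. slice_eval n P q = 0"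
    unfolding Q(2) using Q(1) comm assms(2)
    by (intro ballI slice_eval_slice_comb[where N = "\<lambda>l. n"]) auto
qed

end
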